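(* Let $V=(V_t)_{t\ge 0}$ be an $\mathbb{R}^d$-valued progressively measurable process, regular enough that $\phi^u_t$ is measurable for all $u\in S^{d-1}$, $t>0$. Assume that for every $u\in S^{d-1}$, every $t>0$ and every $b\in\mathbb{R}\cup\{\pm\infty\}$ we have $\mathbb{P}(\phi^u_t=b)=0$. Then for any $t>0$ and $u\in S^{d-1}$ the map $b\mapsto F^u_b(t)$ is monotone non-increasing and continuous, with $\lim_{b\to\infty}F^u_b(t)=0$ and $\lim_{b\to-\infty}F^u_b(t)=1$.
   Context: Fix $d\ge1$, $S^{d-1}=\{v\in\mathbb{R}^d:\|v\|=1\}$ (Euclidean norm, inner product $\langle\cdot,\cdot\rangle$). For $u\in S^{d-1}$, $b\in\mathbb{R}$, let $\Pi^+(u,b)=\{v\in\mathbb{R}^d:\langle u,v\rangle\ge b\}$. For a set $A\subseteq\mathbb{R}^d$ the hitting time is $\tau_A=\inf\{t\ge0:V_t\in A\}$, with $\inf\emptyset=+\infty$; hitting times are taken to be random variables. Define $F^u_b(t)=\mathbb{P}(\tau_{\Pi^+(u,b)}\le t)$ for $t\ge 0$, and $\phi^u_t=\sup_{s\in[0,t]}\langle V_s,u\rangle$ (extended-real-valued). The regularity making $\phi^u_t$ measurable is not further specified; for instance càdlàg paths, or a discrete model for $V$, may be assumed.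
   Formalization: The paths of V are assumed almost surely right-continuous (implied by càdlàg); measurability of the running suprema alone does not suffice, since a left-continuous process with a jump at a fixed time can make F discontinuous in b. *)

theory Defs
  imports "HOL-Probability.Probability"
begin

(* A filtration with time set [0, \<infinity>).  The library locale filtration ranges over
   a whole index type; here the values F t for t < 0 play no role. *)
definition filtration_on_nonneg :: "'a measure \<Rightarrow> (real \<Rightarrow> 'a measure) \<Rightarrow> bool" where
  "filtration_on_nonneg M F \<longleftrightarrow>
     (\<forall>t\<ge>0. subalgebra M (F t)) \<and>
     (\<forall>s t. 0 \<le> s \<and> s \<le> t \<longrightarrow> sets (F s) \<subseteq> sets (F t))"

definition progressively_measurable ::
    "(real \<Rightarrow> 'a measure) \<Rightarrow> (real \<Rightarrow> 'a \<Rightarrow> 'b::topological_space) \<Rightarrow> bool" where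
  "progressively_measurable F V \<longleftrightarrow>
     (\<forall>t\<ge>0. (\<lambda>(s, \<omega>). V s \<omega>) \<in> borel_measurable (restrict_space borel {0..t} \<Otimes>\<^sub>M F t))"

definition halfspace_plus :: "'b::real_inner \<Rightarrow> real \<Rightarrow> 'b set" where
  "halfspace_plus u b = {v. u \<bullet> v \<ge> b}"

(* In ereal the infimum of the empty set is \<infinity>. *)
definition hitting_time :: "(real \<Rightarrow> 'a \<Rightarrow> 'b) \<Rightarrow> 'b set \<Rightarrow> 'a \<Rightarrow> ereal" where
  "hitting_time V A \<omega> = (INF t \<in> {t. 0 \<le> t \<and> V t \<omega> \<in> A}. ereal t)"

definition hitting_cdf ::
    "'a measure \<Rightarrow> (real \<Rightarrow> 'a \<Rightarrow> 'b::real_inner) \<Rightarrow> 'b \<Rightarrow> real \<Rightarrow> real \<Rightarrow> real" where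
  "hitting_cdf M V u b t =
     measure M {\<omega> \<in> space M. hitting_time V (halfspace_plus u b) \<omega> \<le> ereal t}"

definition running_sup :: "(real \<Rightarrow> 'a \<Rightarrow> 'b::real_inner) \<Rightarrow> 'b \<Rightarrow> real \<Rightarrow> 'a \<Rightarrow> ereal" where
  "running_sup V u t \<omega> = (SUP s \<in> {0..t}. ereal (V s \<omega> \<bullet> u))"

(* The standing path regularity.  It holds for cadlag paths and for discrete-time models
   viewed as right-continuous step processes.  Measurability of the running suprema
   alone does not suffice: for independent X, Y uniform on (-1, 0) and (0, 1), the process
   V_s = X for s \<le> 1, V_s = (s - 1) * Y for s > 1 has atomless running suprema in both
   directions u = 1 and u = -1, yet for u = 1 hits [0, \<infinity>) at time 1 and
   [b, \<infinity>) only after time 1 when b > 0. *)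
definition right_continuous_paths ::
    "'a measure \<Rightarrow> (real \<Rightarrow> 'a \<Rightarrow> 'b::topological_space) \<Rightarrow> bool" where
  "right_continuous_paths M V \<longleftrightarrow>
     (AE \<omega> in M. \<forall>t\<ge>0. continuous (at_right t) (\<lambda>s. V s \<omega>))"

end

theory Submission
  imports Defs
begin

text \<open>Right-continuity sandwiches the event that the hitting time is at most \<open>t\<close> between
  the events that the running supremum exceeds \<open>b\<close> and that it is at least \<open>b\<close>.  These differ
  by a null set, so the hitting probability is one minus the distribution function at \<open>b\<close> of
  the almost surely finite running supremum, whose law has no atoms.\<close>

text \<open>A supremum strictly above \<open>b\<close> is approximated by a value above
  \<open>b\<close> at some time in \<open>{0..t}\<close>, and that time is a hit. Strictness
  matters: a supremum equal to \<open>b\<close> might not be attained. No path regularity enters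
  here.\<close>

lemma hitting_time_le_if_less_running_sup:
  assumes "ereal b < running_sup V u t \<omega>"
  shows "hitting_time V (halfspace_plus u b) \<omega> \<le> ereal t"
proof -
  obtain s where "s \<in> {0..t}" "b < V s \<omega> \<bullet> u"
    using assms by (auto simp: running_sup_def less_SUP_iff)
  then show ?thesis
    unfolding hitting_time_def
    by (intro INF_lower2[of s]) (auto simp: halfspace_plus_def inner_commute)
qed

text \<open>By right-continuity at \<open>t\<close>, a path that stays below \<open>b\<close> up to time \<open>t\<close> does so
  slightly longer.\<close>

lemma le_running_sup_if_hitting_time_le:
  assumes hit: "hitting_time V (halfspace_plus u b) \<omega> \<le> ereal t"
    and cont: "continuous (at_right t) (\<lambda>s. V s \<omega>)"
    and "0 \<le> t"
  shows "ereal b \<le> running_sup V u t \<omega>"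
proof (rule ccontr)
  assume "\<not> ereal b \<le> running_sup V u t \<omega>"
  then have less: "running_sup V u t \<omega> < ereal b" by simp
  have below: "u \<bullet> V s \<omega> < b" if "s \<in> {0..t}" for s
  proof -
    have "ereal (V s \<omega> \<bullet> u) \<le> running_sup V u t \<omega>"
      unfolding running_sup_def using that by (intro SUP_upper)
    with less have "ereal (V s \<omega> \<bullet> u) < ereal b" by (rule le_less_trans[rotated])
    then show ?thesis by (simp add: inner_commute)
  qed
  have "((\<lambda>s. u \<bullet> V s \<omega>) \<longlongrightarrow> u \<bullet> V t \<omega>) (at_right t)"
    using cont by (intro tendsto_intros) (simp add: continuous_within)
  then have "\<forall>\<^sub>F s in at_right t. u \<bullet> V s \<omega> < b"
    using below[of t] \<open>0 \<le> t\<close> by (intro order_tendstoD) auto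
  then obtain r where r: "r > t" "\<And>s. t < s \<Longrightarrow> s < r \<Longrightarrow> u \<bullet> V s \<omega> < b"
    by (auto simp: eventually_at_right_field)
  \<comment> \<open>The hitting time is an infimum that need not be attained, so the absence of hits
    up to \<open>t\<close> does not yet exclude the value \<open>t\<close>. The margin up to
    \<open>r\<close> does.\<close>
  have "ereal r \<le> hitting_time V (halfspace_plus u b) \<omega>"
    unfolding hitting_time_def
  proof (rule INF_greatest)
    fix s assume "s \<in> {s. 0 \<le> s \<and> V s \<omega> \<in> halfspace_plus u b}"
    then have "0 \<le> s" "\<not> u \<bullet> V s \<omega> < b" by (auto simp: halfspace_plus_def)
    then show "ereal r \<le> ereal s"
      using below[of s] r(2)[of s] by (cases "s \<le> t") (auto simp: not_less[symmetric])
  qed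
  with hit have "ereal r \<le> ereal t" by (rule order_trans[rotated])
  with r(1) show False by simp
qed

text \<open>Singletons are closed in a T1 space, so the event is measurable and its zero probability
  makes it a genuine null set. For a nonmeasurable set, \<open>measure\<close> would be 0 by
  convention.\<close>

lemma (in prob_space) AE_neq_if_prob_eq_0:
  fixes X :: "'a \<Rightarrow> 'b::t1_space"
  assumes "X \<in> borel_measurable M" "prob {\<omega> \<in> space M. X \<omega> = c} = 0"
  shows "AE \<omega> in M. X \<omega> \<noteq> c"
proof -
  have "{\<omega> \<in> space M. X \<omega> = c} = X -` {c} \<inter> space M" by auto
  also have "\<dots> \<in> events" using assms(1) by (rule measurable_sets) simp
  finally show ?thesis
    using assms(2) by (intro AE_I[of _ _ "{\<omega> \<in> space M. X \<omega> = c}"]) (auto simp: emeasure_eq_measure)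
qed

text \<open>The distribution function jumps at \<open>x\<close> by exactly the mass of
  \<open>{x}\<close>, so without atoms it is continuous; monotonicity and the limits hold for every
  real distribution.\<close>

lemma (in real_distribution) complementary_cdf_properties:
  assumes "\<And>x. measure M {x} = 0"
  shows "antimono (\<lambda>x. 1 - cdf M x)" "continuous_on UNIV (\<lambda>x. 1 - cdf M x)"
    "((\<lambda>x. 1 - cdf M x) \<longlongrightarrow> 0) at_top" "((\<lambda>x. 1 - cdf M x) \<longlongrightarrow> 1) at_bot"
proof -
  show "antimono (\<lambda>x. 1 - cdf M x)"
    by (auto intro!: antimonoI cdf_nondecreasing)
  show "continuous_on UNIV (\<lambda>x. 1 - cdf M x)"
    using assms by (intro continuous_intros continuous_at_imp_continuous_on) (auto simp: isCont_cdf)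
  show "((\<lambda>x. 1 - cdf M x) \<longlongrightarrow> 0) at_top"
    using tendsto_diff[OF tendsto_const[of 1] cdf_lim_at_top_prob] by simp
  show "((\<lambda>x. 1 - cdf M x) \<longlongrightarrow> 1) at_bot"
    using tendsto_diff[OF tendsto_const[of 1] cdf_lim_at_bot] by simp
qed

theorem theorem5p2:
  fixes M :: "'a measure"
    and F :: "real \<Rightarrow> 'a measure"
    and V :: "real \<Rightarrow> 'a \<Rightarrow> real ^ 'd"
  assumes "prob_space M"
    and "filtration_on_nonneg M F"
    and "progressively_measurable F V"
    and "right_continuous_paths M V"
    and "\<And>u t. norm u = 1 \<Longrightarrow> t > 0 \<Longrightarrow> running_sup V u t \<in> borel_measurable M"
    and "\<And>u b. norm u = 1 \<Longrightarrow> hitting_time V (halfspace_plus u b) \<in> borel_measurable M"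
    and "\<And>u t (b :: ereal). norm u = 1 \<Longrightarrow> t > 0 \<Longrightarrow>
           measure M {\<omega> \<in> space M. running_sup V u t \<omega> = b} = 0"
  shows "\<forall>t>0. \<forall>u. norm u = 1 \<longrightarrow>
           antimono (\<lambda>b. hitting_cdf M V u b t) \<and>
           continuous_on UNIV (\<lambda>b. hitting_cdf M V u b t) \<and>
           ((\<lambda>b. hitting_cdf M V u b t) \<longlongrightarrow> 0) at_top \<and>
           ((\<lambda>b. hitting_cdf M V u b t) \<longlongrightarrow> 1) at_bot"
proof (intro allI impI)
  fix t :: real and u :: "real ^ 'd"
  assume t: "t > 0" and u: "norm u = 1"
  interpret prob_space M by fact
  let ?\<phi> = "running_sup V u t"
  \<comment> \<open>A real-valued version of the running supremum, so that its law is a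
    \<open>real_distribution\<close>. Infinite values are sent to 0.\<close>
  define X where "X = (\<lambda>\<omega>. real_of_ereal (?\<phi> \<omega>))"
  have phi [measurable]: "?\<phi> \<in> borel_measurable M" by (rule assms(5)[OF u t])
  have X [measurable]: "X \<in> borel_measurable M" unfolding X_def by measurable
  have hit [measurable]: "hitting_time V (halfspace_plus u b) \<in> borel_measurable M" for b
    by (rule assms(6)[OF u])
  have neq: "AE \<omega> in M. ?\<phi> \<omega> \<noteq> c" for c
    by (rule AE_neq_if_prob_eq_0[OF phi assms(7)[OF u t]])
  \<comment> \<open>The hypothesis at the levels \<infinity> and -\<infinity> makes the default
    value 0 harmless.\<close>
  have fin: "AE \<omega> in M. ereal (X \<omega>) = ?\<phi> \<omega>"
    using neq[of \<infinity>] neq[of "-\<infinity>"] by eventually_elim (auto simp: X_def ereal_real)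
  interpret D: real_distribution "distr M borel X"
    by (rule real_distribution_distr) (rule X)
  have atom: "measure (distr M borel X) {c} = 0" for c
  proof -
    have "AE \<omega> in M. X \<omega> \<noteq> c"
      using neq[of "ereal c"] fin by eventually_elim auto
    then have "prob {\<omega> \<in> space M. X \<omega> = c} = 0"
      by (intro prob_eq_0_AE) auto
    moreover have "X -` {c} \<inter> space M = {\<omega> \<in> space M. X \<omega> = c}" by auto
    ultimately show ?thesis by (simp add: measure_distr)
  qed
  have cdf: "hitting_cdf M V u b t = 1 - cdf (distr M borel X) b" for b
  proof -
    \<comment> \<open>The inclusions from the two hitting lemmas leave only the case
      \<open>?\<phi> \<omega> = ereal b\<close> undecided, and \<open>neq\<close> discards it as a
      null event.\<close>
    have "AE \<omega> in M. hitting_time V (halfspace_plus u b) \<omega> \<le> ereal t \<longleftrightarrow> \<not> X \<omega> \<le> b"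
      using assms(4)[unfolded right_continuous_paths_def] fin neq[of "ereal b"]
    proof eventually_elim
      case (elim \<omega>)
      have "hitting_time V (halfspace_plus u b) \<omega> \<le> ereal t \<longleftrightarrow> ereal b < ?\<phi> \<omega>"
        using hitting_time_le_if_less_running_sup[of b V u t \<omega>]
          le_running_sup_if_hitting_time_le[of V u b \<omega> t] elim(1,3) t
        by (auto simp: less_le)
      then show ?case using elim(2)[symmetric] by (auto simp: not_le)
    qed
    then have "hitting_cdf M V u b t = prob {\<omega> \<in> space M. \<not> X \<omega> \<le> b}"
      unfolding hitting_cdf_def by (intro finite_measure_eq_AE) auto
    also have "\<dots> = 1 - prob {\<omega> \<in> space M. X \<omega> \<le> b}"
      by (rule prob_neg) measurable
    also have "{\<omega> \<in> space M. X \<omega> \<le> b} = X -` {..b} \<inter> space M" by auto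
    finally show ?thesis by (simp add: cdf_def measure_distr)
  qed
  show "antimono (\<lambda>b. hitting_cdf M V u b t) \<and>
      continuous_on UNIV (\<lambda>b. hitting_cdf M V u b t) \<and>
      ((\<lambda>b. hitting_cdf M V u b t) \<longlongrightarrow> 0) at_top \<and>
      ((\<lambda>b. hitting_cdf M V u b t) \<longlongrightarrow> 1) at_bot"
    unfolding cdf using D.complementary_cdf_properties[OF atom] by blast
qed

end
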